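(* Let $n\ge 2$ be an integer, let $\alpha,\lambda\in[0,1]$, and suppose two parties $A$ and $B$ share $n$ identical copies of the two-qubit state $$\rho(\alpha,\lambda)=\lambda\,|\alpha\rangle\langle\alpha|+(1-\lambda)\,|01\rangle\langle 01|,\qquad |\alpha\rangle=\sqrt{\alpha}\,|00\rangle+\sqrt{1-\alpha}\,|11\rangle,$$ where in each copy the first qubit is held by $A$ and the second by $B$. Then there is a protocol consisting of local operations by $A$ and $B$ and classical communication between them that converts $\rho(\alpha,\lambda)^{\otimes n}$ into a singlet with success probability $$p_n=\sum_{m=0}^{n}\lambda^{n-m}(1-\lambda)^m\binom{n}{m}\left(\sum_{k=1}^{n-m-1}\frac{\alpha^{n-m-k}(1-\alpha)^k\binom{n-m}{k}\left(\binom{n-m}{k}-1\right)}{\binom{n}{k}-1}\right),$$ where empty sums are zero.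
   Context: A singlet means a two-qubit maximally entangled pure state shared by $A$ and $B$, i.e. $(|00\rangle+|11\rangle)/\sqrt2$ up to local unitaries. Success means that the protocol ends with an outcome, known to the parties, conditioned on which they share exactly such a state; the success probability is the total probability of all such outcomes. Maximally entangled states supported on a two-dimensional subspace of $A$'s $n$ qubits and a two-dimensional subspace of $B$'s $n$ qubits are identified with singlets, since they are mapped to one by local unitaries. Convention: $0^0=1$. *)

theory Defs
  imports Complex_Main "Jordan_Normal_Form.Schur_Decomposition"
begin

text \<open>
  States of a system with local dimensions \<open>dA\<close> (party A) and \<open>dB\<close> (party B) are complex matrices
  of dimension \<open>dA * dB\<close>; the basis vector with index \<open>a * dB + b\<close> is the product of the basis
  vector \<open>a\<close> of A and the basis vector \<open>b\<close> of B. This is the index convention of the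
  Kronecker product below.
\<close>

definition tensor_mat :: "complex mat \<Rightarrow> complex mat \<Rightarrow> complex mat" where
  "tensor_mat A B =
    mat (dim_row A * dim_row B) (dim_col A * dim_col B)
      (\<lambda>(i, j). A $$ (i div dim_row B, j div dim_col B) * B $$ (i mod dim_row B, j mod dim_col B))"

definition ketbra :: "complex vec \<Rightarrow> complex mat" where
  "ketbra v = mat (dim_vec v) (dim_vec v) (\<lambda>(i, j). v $ i * cnj (v $ j))"

definition mat_trace :: "complex mat \<Rightarrow> complex" where
  "mat_trace A = (\<Sum>i<dim_row A. A $$ (i, i))"

definition mat_sum :: "nat \<Rightarrow> complex mat list \<Rightarrow> complex mat" where
  "mat_sum d As = foldr (+) As (0\<^sub>m d d)"


text \<open>Two-qubit vectors use the order 00, 01, 10, 11, the first qubit being A's.\<close>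

definition ket_alpha :: "real \<Rightarrow> complex vec" where
  "ket_alpha \<alpha> =
    complex_of_real (sqrt \<alpha>) \<cdot>\<^sub>v unit_vec 4 0 + complex_of_real (sqrt (1 - \<alpha>)) \<cdot>\<^sub>v unit_vec 4 3"

definition ket_01 :: "complex vec" where
  "ket_01 = unit_vec 4 1"

definition rho :: "real \<Rightarrow> real \<Rightarrow> complex mat" where
  "rho \<alpha> l =
    complex_of_real l \<cdot>\<^sub>m ketbra (ket_alpha \<alpha>) + complex_of_real (1 - l) \<cdot>\<^sub>m ketbra ket_01"


text \<open>
  The tensor power of a two-qubit state, with the \<open>2n\<close> qubits regrouped as A's \<open>n\<close> qubits
  followed by B's \<open>n\<close> qubits. Qubit \<open>i\<close> of the basis vector \<open>x < 2 ^ n\<close> of one party is the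
  binary digit \<open>i\<close> of \<open>x\<close>; a basis vector \<open>r < 2 ^ n * 2 ^ n\<close> of the whole system is the pair
  \<open>(r div 2 ^ n, r mod 2 ^ n)\<close>, and \<open>copy_index n r i\<close> is the two-qubit basis vector it
  induces on copy \<open>i\<close>.
\<close>

definition qubit :: "nat \<Rightarrow> nat \<Rightarrow> nat" where
  "qubit x i = x div 2 ^ i mod 2"

definition copy_index :: "nat \<Rightarrow> nat \<Rightarrow> nat \<Rightarrow> nat" where
  "copy_index n r i = 2 * qubit (r div 2 ^ n) i + qubit (r mod 2 ^ n) i"

definition shared_copies :: "nat \<Rightarrow> complex mat \<Rightarrow> complex mat" where
  "shared_copies n \<sigma> =
    mat (2 ^ n * 2 ^ n) (2 ^ n * 2 ^ n)
      (\<lambda>(r, c). \<Prod>i<n. \<sigma> $$ (copy_index n r i, copy_index n c i))"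


text \<open>
  A finite-round protocol is a tree. At a node one party performs an instrument: each branch
  \<open>(e, Ks, Q)\<close> is an outcome whose completely positive map has the Kraus operators \<open>Ks\<close>,
  where \<open>e\<close> is the output dimension of that party and \<open>Q\<close> is the continuation once the outcome
  has been announced to the other party. Several Kraus operators in one branch model
  information that is lost; the free choice of \<open>e\<close> accommodates ancillas, private
  classical memory and discarded subsystems. A leaf is thus a full classical transcript, known
  to both parties.
\<close>

datatype protocol =
    Done
  | By_A "(nat \<times> complex mat list \<times> protocol) list"
  | By_B "(nat \<times> complex mat list \<times> protocol) list"

definition instrument :: "nat \<Rightarrow> (nat \<times> complex mat list) list \<Rightarrow> bool" where
  "instrument d bs \<longleftrightarrow>
    (\<forall>(e, Ks) \<in> set bs. \<forall>K \<in> set Ks. K \<in> carrier_mat e d) \<and>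
    mat_sum d (map (\<lambda>K. mat_adjoint K * K) (concat (map snd bs))) = 1\<^sub>m d"

fun locc :: "nat \<Rightarrow> nat \<Rightarrow> protocol \<Rightarrow> bool" where
  "locc dA dB Done \<longleftrightarrow> True"
| "locc dA dB (By_A bs) \<longleftrightarrow>
    instrument dA (map (\<lambda>(e, Ks, Q). (e, Ks)) bs) \<and> (\<forall>(e, Ks, Q) \<in> set bs. locc e dB Q)"
| "locc dA dB (By_B bs) \<longleftrightarrow>
    instrument dB (map (\<lambda>(e, Ks, Q). (e, Ks)) bs) \<and> (\<forall>(e, Ks, Q) \<in> set bs. locc dA e Q)"

definition apply_kraus :: "nat \<Rightarrow> complex mat list \<Rightarrow> complex mat \<Rightarrow> complex mat" where
  "apply_kraus d Ks \<sigma> = mat_sum d (map (\<lambda>K. K * \<sigma> * mat_adjoint K) Ks)"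

text \<open>
  One entry \<open>(dA, dB, \<sigma>)\<close> per leaf: the final local dimensions and the unnormalised
  conditional state, whose trace is the probability of reaching that leaf.
\<close>

fun outcomes :: "nat \<Rightarrow> nat \<Rightarrow> protocol \<Rightarrow> complex mat \<Rightarrow> (nat \<times> nat \<times> complex mat) list" where
  "outcomes dA dB Done \<sigma> = [(dA, dB, \<sigma>)]"
| "outcomes dA dB (By_A bs) \<sigma> =
    concat (map (\<lambda>(e, Ks, Q).
      outcomes e dB Q (apply_kraus (e * dB) (map (\<lambda>K. tensor_mat K (1\<^sub>m dB)) Ks) \<sigma>)) bs)"
| "outcomes dA dB (By_B bs) \<sigma> =
    concat (map (\<lambda>(e, Ks, Q).
      outcomes dA e Q (apply_kraus (dA * e) (map (\<lambda>K. tensor_mat (1\<^sub>m dA) K) Ks) \<sigma>)) bs)"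


definition isometry :: "nat \<Rightarrow> nat \<Rightarrow> complex mat \<Rightarrow> bool" where
  "isometry d e V \<longleftrightarrow> V \<in> carrier_mat e d \<and> mat_adjoint V * V = 1\<^sub>m d"

definition bell_vec :: "complex vec" where
  "bell_vec = complex_of_real (1 / sqrt 2) \<cdot>\<^sub>v (unit_vec 4 0 + unit_vec 4 3)"

text \<open>
  For \<open>dA = dB = 2\<close> the isometries are the local unitaries. In larger dimensions the same
  formula describes the maximally entangled pure states supported on a two-dimensional subspace
  of each party, which are identified with singlets.
\<close>

definition singlet :: "nat \<Rightarrow> nat \<Rightarrow> complex mat \<Rightarrow> bool" where
  "singlet dA dB \<sigma> \<longleftrightarrow>
    (\<exists>V W. isometry 2 dA V \<and> isometry 2 dB W \<and>
      \<sigma> = tensor_mat V W * ketbra bell_vec * mat_adjoint (tensor_mat V W))"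

definition success :: "nat \<times> nat \<times> complex mat \<Rightarrow> bool" where
  "success = (\<lambda>(dA, dB, \<sigma>).
    mat_trace \<sigma> \<noteq> 0 \<and> (\<exists>\<tau>. singlet dA dB \<tau> \<and> \<sigma> = mat_trace \<sigma> \<cdot>\<^sub>m \<tau>))"

definition success_probability :: "nat \<Rightarrow> nat \<Rightarrow> protocol \<Rightarrow> complex mat \<Rightarrow> real" where
  "success_probability dA dB P \<sigma> =
    (\<Sum>(eA, eB, \<tau>) \<leftarrow> filter success (outcomes dA dB P \<sigma>). Re (mat_trace \<tau>))"

end

theory Submission
  imports Defs "HOL-Library.Nat_Bijection"
begin

text \<open>
  Expand the copies in the computational basis: if \<open>Z\<close> is the set of copies in state \<open>|01>\<close> and
  \<open>X\<close>, disjoint from \<open>Z\<close>, the set of ones on A's side, then B holds \<open>X \<union> Z\<close>. For \<open>k = card X\<close>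
  the amplitude depends only on \<open>k\<close> and \<open>card Z\<close>. A applies a measurement that projects onto the span of
  two basis vectors \<open>X \<noteq> Y\<close> of equal weight and announces them. B then projects onto the span of
  \<open>X \<union> Z\<close> and \<open>Y \<union> Z\<close> for the sets \<open>Z\<close> disjoint from \<open>X \<union> Y\<close>; since \<open>X\<close> and \<open>Y\<close> are
  incomparable, these planes are orthogonal for different \<open>Z\<close>, and what survives in the plane of \<open>Z\<close>
  is the singlet \<open>|X, X \<union> Z> + |Y, Y \<union> Z>\<close>. Summing the weights of all triples \<open>(X, Y, Z)\<close>
  gives \<open>p_n\<close>.
\<close>

subsection \<open>Kraus operators that select basis vectors\<close>

text \<open>This is \<open>c\<close> times the sum of the operators |i><f i| over
  \<open>i < e\<close> when \<open>f\<close> takes values below \<open>d\<close>. Every Kraus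
  operator of the protocol has this form, so completeness and the action on states are computed only
  once.\<close>

definition selection :: "real \<Rightarrow> nat \<Rightarrow> nat \<Rightarrow> (nat \<Rightarrow> nat) \<Rightarrow> complex mat" where
  "selection c e d f = mat e d (\<lambda>(i, j). if j = f i then complex_of_real c else 0)"

lemma selection_carrier [simp]: "selection c e d f \<in> carrier_mat e d"
  by (simp add: selection_def)

lemma dim_selection [simp]: "dim_row (selection c e d f) = e" "dim_col (selection c e d f) = d"
  by (simp_all add: selection_def)

lemma mat_adjoint_index:
  "i < dim_col A \<Longrightarrow> j < dim_row A \<Longrightarrow> mat_adjoint A $$ (i, j) = cnj (A $$ (j, i))"
  by (simp add: mat_adjoint_def mat_of_rows_def)

lemma dim_mat_adjoint [simp]:
  "dim_row (mat_adjoint A) = dim_col A" "dim_col (mat_adjoint A) = dim_row A"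
  by (simp_all add: mat_adjoint_def)

text \<open>Each row has at most one nonzero entry, so distinct columns never overlap and the Gram
  matrix is diagonal.\<close>

lemma selection_gram_index:
  assumes "i < d" "j < d"
  shows "(mat_adjoint (selection c e d f) * selection c e d f) $$ (i, j) =
    (if i = j then complex_of_real (\<Sum>r<e. if f r = i then c\<^sup>2 else 0) else 0)"
proof -
  have "(mat_adjoint (selection c e d f) * selection c e d f) $$ (i, j) =
    (\<Sum>r<e. if i = j then complex_of_real (if f r = i then c\<^sup>2 else 0) else 0)"
    using assms
    by (auto simp: scalar_prod_def mat_adjoint_index selection_def power2_eq_square
        atLeast0LessThan intro!: sum.cong)
  then show ?thesis by simp
qed

lemma selection_conjugate:
  assumes "\<sigma> \<in> carrier_mat d d" "\<And>i. i < e \<Longrightarrow> f i < d"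
  shows "selection c e d f * \<sigma> * mat_adjoint (selection c e d f) =
    mat e e (\<lambda>(i, j). complex_of_real (c\<^sup>2) * \<sigma> $$ (f i, f j))"
proof (rule eq_matI)
  fix i j
  let ?R = "mat e e (\<lambda>(i, j). complex_of_real (c\<^sup>2) * \<sigma> $$ (f i, f j))"
  assume "i < dim_row ?R" "j < dim_col ?R"
  then have ij: "i < e" "j < e" by auto
  have row: "(selection c e d f * \<sigma>) $$ (i, k) = complex_of_real c * \<sigma> $$ (f i, k)" if "k < d" for k
  proof -
    have "(selection c e d f * \<sigma>) $$ (i, k) =
        (\<Sum>r<d. (if r = f i then complex_of_real c else 0) * \<sigma> $$ (r, k))"
      using assms(1) ij that by (simp add: scalar_prod_def selection_def atLeast0LessThan)
    also have "\<dots> = (\<Sum>r<d. if r = f i then complex_of_real c * \<sigma> $$ (r, k) else 0)"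
      by (intro sum.cong) auto
    finally show ?thesis using assms(2) ij by simp
  qed
  have "(selection c e d f * \<sigma> * mat_adjoint (selection c e d f)) $$ (i, j) =
      (\<Sum>k<d. (selection c e d f * \<sigma>) $$ (i, k) * mat_adjoint (selection c e d f) $$ (k, j))"
    using assms(1) ij by (simp add: scalar_prod_def atLeast0LessThan)
  also have "\<dots> = (\<Sum>k<d. if k = f j then complex_of_real (c * c) * \<sigma> $$ (f i, k) else 0)"
    using ij row by (intro sum.cong) (auto simp: mat_adjoint_index selection_def)
  also have "\<dots> = (complex_of_real c)\<^sup>2 * \<sigma> $$ (f i, f j)"
    using assms(2) ij by (simp add: power2_eq_square)
  finally show "(selection c e d f * \<sigma> * mat_adjoint (selection c e d f)) $$ (i, j) = ?R $$ (i, j)"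
    using ij by simp
qed (use assms in auto)

lemma one_mat_eq_selection: "1\<^sub>m d = selection 1 d d (\<lambda>i. i)"
  by (rule eq_matI) (auto simp: selection_def)

text \<open>The bound on \<open>g\<close> makes \<open>g (i mod e')\<close> a genuine remainder
  modulo \<open>d'\<close>, so the column conditions of the two factors merge into a single one.
  With \<open>one_mat_eq_selection\<close> this covers operators that act on one party only.\<close>

lemma tensor_selection:
  assumes "\<And>i. i < e' \<Longrightarrow> g i < d'"
  shows "tensor_mat (selection c e d f) (selection c' e' d' g) =
    selection (c * c') (e * e') (d * d') (\<lambda>i. f (i div e') * d' + g (i mod e'))"
proof (rule eq_matI; simp add: tensor_mat_def)
  fix i j assume ij: "i < e * e'" "j < d * d'"
  \<comment> \<open>Indices in range exist only if these factors are positive, which the laws of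
    \<open>div\<close> and \<open>mod\<close> require.\<close>
  then have "0 < e'" "0 < d'" by (auto intro: gr0I)
  with ij have b: "i div e' < e" "i mod e' < e'" "j div d' < d" "j mod d' < d'"
    by (auto simp: less_mult_imp_div_less)
  have "j = f (i div e') * d' + g (i mod e') \<longleftrightarrow> j div d' = f (i div e') \<and> j mod d' = g (i mod e')"
    using assms[OF b(2)] by (metis div_mod_decomp div_mult_self3 mod_mult_self3 mod_less add_cancel_right_right \<open>0 < d'\<close> less_nat_zero_code)
  then show "selection c e d f $$ (i div e', j div d') * selection c' e' d' g $$ (i mod e', j mod d') =
       selection (c * c') (e * e') (d * d') (\<lambda>i. f (i div e') * d' + g (i mod e')) $$ (i, j)"
    using ij b by (auto simp: selection_def)
qed

lemma mat_sum_carrier_index: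
  assumes "set As \<subseteq> carrier_mat d d"
  shows "mat_sum d As \<in> carrier_mat d d"
    and "i < d \<Longrightarrow> j < d \<Longrightarrow> mat_sum d As $$ (i, j) = (\<Sum>A\<leftarrow>As. A $$ (i, j))"
proof -
  have "mat_sum d As \<in> carrier_mat d d \<and>
    (i < d \<longrightarrow> j < d \<longrightarrow> mat_sum d As $$ (i, j) = (\<Sum>A\<leftarrow>As. A $$ (i, j)))"
    using assms by (induction As) (auto simp: mat_sum_def)
  then show "mat_sum d As \<in> carrier_mat d d"
    and "i < d \<Longrightarrow> j < d \<Longrightarrow> mat_sum d As $$ (i, j) = (\<Sum>A\<leftarrow>As. A $$ (i, j))" by auto
qed

text \<open>As all Gram matrices are diagonal, completeness becomes a scalar condition: every input
  basis vector is selected with total weight 1.\<close>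

lemma instrument_selection:
  assumes "\<And>j. j < d \<Longrightarrow>
    (\<Sum>(e, ps)\<leftarrow>bs. \<Sum>(c, f)\<leftarrow>ps. \<Sum>r<e. if f r = j then c\<^sup>2 else 0) = 1"
  shows "instrument d (map (\<lambda>(e, ps). (e, map (\<lambda>(c, f). selection c e d f) ps)) bs)"
proof -
  define Ks where "Ks = concat (map (\<lambda>(e, ps). map (\<lambda>(c, f). selection c e d f) ps) bs)"
  have gram_entry: "(\<Sum>K\<leftarrow>Ks. (mat_adjoint K * K) $$ (i, j)) = (if i = j then 1 else 0)"
    if "i < d" "j < d" for i j
  proof -
    have "(\<Sum>K\<leftarrow>Ks. (mat_adjoint K * K) $$ (i, j)) = (if i = j then complex_of_real
        (\<Sum>(e, ps)\<leftarrow>bs. \<Sum>(c, f)\<leftarrow>ps. \<Sum>r<e. if f r = i then c\<^sup>2 else 0) else 0)"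
      unfolding Ks_def
    proof (induction bs)
      case (Cons b bs)
      obtain e ps where b: "b = (e, ps)" by (cases b)
      have "(\<Sum>K\<leftarrow>map (\<lambda>(c, f). selection c e d f) ps. (mat_adjoint K * K) $$ (i, j)) =
        (if i = j then complex_of_real (\<Sum>(c, f)\<leftarrow>ps. \<Sum>r<e. if f r = i then c\<^sup>2 else 0) else 0)"
        using that by (induction ps) (auto simp: selection_gram_index simp del: index_mult_mat)
      with Cons.IH show ?case by (auto simp: b)
    qed simp
    then show ?thesis using assms that by simp
  qed
  have carr: "set (map (\<lambda>K. mat_adjoint K * K) Ks) \<subseteq> carrier_mat d d"
    by (auto simp: Ks_def)
  have "mat_sum d (map (\<lambda>K. mat_adjoint K * K) Ks) = 1\<^sub>m d"
  proof (rule eq_matI)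
    fix i j assume "i < dim_row (1\<^sub>m d :: complex mat)" "j < dim_col (1\<^sub>m d :: complex mat)"
    then have ij: "i < d" "j < d" by auto
    show "mat_sum d (map (\<lambda>K. mat_adjoint K * K) Ks) $$ (i, j) = 1\<^sub>m d $$ (i, j)"
      unfolding mat_sum_carrier_index(2)[OF carr ij] using gram_entry[OF ij] ij
      by (simp add: o_def del: index_mult_mat)
  qed (use mat_sum_carrier_index(1)[OF carr] in auto)
  then show ?thesis
    by (auto simp: instrument_def Ks_def map_concat o_def case_prod_unfold)
qed

section \<open>Success probabilities of trees and leaves\<close>

text \<open>Two orthonormal vectors do not fit into dimension 1. This is why the failing branches
  contribute nothing, so their states need not be computed.\<close>

lemma not_isometry_2_1: "\<not> isometry 2 (Suc 0) V"
proof
  assume "isometry 2 (Suc 0) V"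
  then have V: "V \<in> carrier_mat 1 2" and eq: "mat_adjoint V * V = 1\<^sub>m 2"
    by (auto simp: isometry_def)
  have e: "cnj (V $$ (0, i)) * V $$ (0, j) = (if i = j then 1 else 0)" if "i < 2" "j < 2" for i j
    using arg_cong[OF eq, of "\<lambda>M. M $$ (i, j)"] V that
    by (simp add: scalar_prod_def mat_adjoint_index)
  from e[of 0 0] e[of 0 1] e[of 1 1] show False by auto
qed

lemma success_probability_Done_dim_1 [simp]:
  "success_probability (Suc 0) dB Done \<sigma> = 0" "success_probability dA (Suc 0) Done \<sigma> = 0"
  using not_isometry_2_1 by (simp_all add: success_probability_def success_def singlet_def)

lemma sum_list_filter_concat:
  "(\<Sum>x\<leftarrow>filter P (concat xss). f x) = (\<Sum>xs\<leftarrow>xss. \<Sum>x\<leftarrow>filter P xs. (f x :: 'a :: comm_monoid_add))"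
  by (induction xss) auto

lemma success_probability_By_A:
  "success_probability dA dB (By_A bs) \<sigma> = (\<Sum>(e, Ks, Q)\<leftarrow>bs. success_probability e dB Q
      (apply_kraus (e * dB) (map (\<lambda>K. tensor_mat K (1\<^sub>m dB)) Ks) \<sigma>))"
  by (simp add: success_probability_def sum_list_filter_concat o_def case_prod_unfold)

lemma success_probability_By_B:
  "success_probability dA dB (By_B bs) \<sigma> = (\<Sum>(e, Ks, Q)\<leftarrow>bs. success_probability dA e Q
      (apply_kraus (dA * e) (map (\<lambda>K. tensor_mat (1\<^sub>m dA) K) Ks) \<sigma>))"
  by (simp add: success_probability_def sum_list_filter_concat o_def case_prod_unfold)

lemma dim_ketbra_bell [simp]: "dim_row (ketbra bell_vec) = 4" "dim_col (ketbra bell_vec) = 4"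
  by (simp_all add: ketbra_def bell_vec_def)

lemma bell_index:
  assumes "i < 4" "j < 4"
  shows "ketbra bell_vec $$ (i, j) = (if i \<in> {0, 3} \<and> j \<in> {0, 3} then 1 / 2 else 0)"
  using assms by (auto simp: ketbra_def bell_vec_def simp flip: of_real_mult)

lemma singlet_bell: "singlet 2 2 (ketbra bell_vec)"
proof -
  have adj: "mat_adjoint (1\<^sub>m d) = (1\<^sub>m d :: complex mat)" for d :: nat
    by (rule eq_matI) (auto simp: mat_adjoint_index)
  have iso: "isometry 2 2 (1\<^sub>m 2)"
    by (simp add: isometry_def adj)
  have "tensor_mat (1\<^sub>m 2) (1\<^sub>m 2) = 1\<^sub>m 4"
    unfolding one_mat_eq_selection by (subst tensor_selection) auto
  moreover have "ketbra bell_vec \<in> carrier_mat 4 4"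
    by (intro carrier_matI) simp_all
  ultimately show ?thesis
    unfolding singlet_def using iso
    by (intro exI[of _ "1\<^sub>m 2"]) (simp add: adj)
qed

lemma success_probability_bell:
  "success_probability 2 2 Done (complex_of_real c \<cdot>\<^sub>m ketbra bell_vec) = c"
proof -
  have tr: "mat_trace (complex_of_real c \<cdot>\<^sub>m ketbra bell_vec) = complex_of_real c"
    by (simp add: mat_trace_def bell_index eval_nat_numeral)
  \<comment> \<open>For \<open>c = 0\<close> the leaf is not a success, but then the empty sum is
    still \<open>c\<close>.\<close>
  show ?thesis
    using singlet_bell by (auto simp: success_probability_def success_def tr)
qed

subsection \<open>Basis vectors as sets of qubits\<close>

lemma set_encode_less: "A \<subseteq> {..<n} \<Longrightarrow> set_encode A < 2 ^ n"
proof -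
  assume "A \<subseteq> {..<n}"
  then have "set_encode A \<le> (\<Sum>i<n. 2 ^ i)"
    unfolding set_encode_def by (intro sum_mono2) auto
  also have "\<dots> = 2 ^ n - 1"
    using sum_power2[of n] by (simp add: atLeast0LessThan)
  also have "\<dots> < (2 :: nat) ^ n" by simp
  finally show ?thesis .
qed

lemma set_decode_subset: "x < 2 ^ n \<Longrightarrow> set_decode x \<subseteq> {..<n}"
proof
  fix i assume "x < 2 ^ n" "i \<in> set_decode x"
  moreover from this(1) have "x < 2 ^ i" if "n \<le> i"
    using that by (meson less_le_trans one_le_numeral power_increasing)
  ultimately show "i \<in> {..<n}" by (force simp: set_decode_def)
qed

lemma qubit_set_encode: "finite A \<Longrightarrow> qubit (set_encode A) i = (if i \<in> A then 1 else 0)"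
  using set_encode_inverse[of A] unfolding set_decode_def qubit_def
  by (auto simp: mod_2_eq_odd)

text \<open>A list because the branches of a protocol form a list; its distinctness later turns list
  sums into sums over sets.\<close>

definition subsets :: "nat \<Rightarrow> nat set list" where
  "subsets n = map set_decode [0..<2 ^ n]"

lemma set_subsets [simp]: "set (subsets n) = Pow {..<n}"
proof -
  have "A \<in> set_decode ` {0..<2 ^ n}" if "A \<subseteq> {..<n}" for A
    using that set_encode_less[OF that] finite_subset[OF that]
    by (intro image_eqI[of _ _ "set_encode A"]) auto
  moreover have "set_decode ` {0..<2 ^ n} \<subseteq> Pow {..<n}"
    using set_decode_subset by force
  ultimately show ?thesis by (auto simp: subsets_def)
qed

lemma distinct_subsets [simp]: "distinct (subsets n)"
  unfolding subsets_def distinct_map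
  by (auto intro!: inj_onI dest: arg_cong[of _ _ set_encode])

lemma set_encode_eq_iff:
  "A \<subseteq> {..<n} \<Longrightarrow> B \<subseteq> {..<n} \<Longrightarrow> set_encode A = set_encode B \<longleftrightarrow> A = B"
  by (intro set_encode_eq) (auto intro: finite_subset)

section \<open>Matrix entries of the shared copies in terms of sets\<close>

text \<open>\<open>s\<close> lists the amplitudes of \<open>ket_alpha\<close>. Index 2, the vector
  |10>, has a vanishing row and column.\<close>

lemma rho_index:
  fixes \<alpha> l :: real
  assumes "p < 4" "q < 4"
  defines "s \<equiv> \<lambda>p :: nat. if p = 0 then sqrt \<alpha> else if p = 3 then sqrt (1 - \<alpha>) else 0"
  shows "rho \<alpha> l $$ (p, q) =
    complex_of_real (l * s p * s q + (if p = 1 \<and> q = 1 then 1 - l else 0))"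
  using assms by (auto simp: rho_def ketbra_def ket_alpha_def ket_01_def)

text \<open>The diagonal entry of the shared state at |X, X \<union> Z> for disjoint X and Z with
  \<open>m = card Z\<close> and \<open>k = card X\<close>: \<open>m\<close> copies are |01>,
  \<open>k\<close> are |11> and the remaining \<open>n - m - k\<close> are |00>.\<close>

definition copies_weight :: "nat \<Rightarrow> real \<Rightarrow> real \<Rightarrow> nat \<Rightarrow> nat \<Rightarrow> real" where
  "copies_weight n \<alpha> l m k = l ^ (n - m) * (1 - l) ^ m * (\<alpha> ^ (n - m - k) * (1 - \<alpha>) ^ k)"

lemma product_index_less:
  fixes a b d e :: nat
  assumes "a < d" "b < e"
  shows "a * e + b < d * e"
proof -
  have "a * e + b < Suc a * e" using assms by simp
  also have "\<dots> \<le> d * e" using assms by (intro mult_right_mono) auto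
  finally show ?thesis .
qed

lemma shared_copies_set_encode:
  assumes "A \<subseteq> {..<n}" "B \<subseteq> {..<n}" "C \<subseteq> {..<n}" "D \<subseteq> {..<n}"
  shows "shared_copies n \<sigma> $$ (set_encode A * 2 ^ n + set_encode B, set_encode C * 2 ^ n + set_encode D) =
    (\<Prod>i<n. \<sigma> $$ (2 * (if i \<in> A then 1 else 0) + (if i \<in> B then 1 else 0),
                 2 * (if i \<in> C then 1 else 0) + (if i \<in> D then 1 else 0)))"
proof -
  have less: "set_encode A' * 2 ^ n + set_encode B' < 2 ^ n * 2 ^ n"
    if "A' \<subseteq> {..<n}" "B' \<subseteq> {..<n}" for A' B'
    using that by (intro product_index_less set_encode_less)
  have fin: "finite A" "finite B" "finite C" "finite D"
    using assms by (auto intro: finite_subset)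
  show ?thesis
    using less assms set_encode_less
    by (simp add: shared_copies_def copy_index_def qubit_set_encode fin)
qed

lemma prod_sqrt_subset:
  assumes "finite U" "X \<subseteq> U" "0 \<le> \<alpha>" "\<alpha> \<le> 1"
  shows "(\<Prod>i\<in>U. if i \<in> X then sqrt (1 - \<alpha>) else sqrt \<alpha>) =
    sqrt (\<alpha> ^ (card U - card X) * (1 - \<alpha>) ^ card X)"
proof -
  have "(\<Prod>i\<in>U. if i \<in> X then sqrt (1 - \<alpha>) else sqrt \<alpha>) =
      sqrt (1 - \<alpha>) ^ card (U \<inter> X) * sqrt \<alpha> ^ card (U \<inter> - X)"
    using assms by (simp add: prod.If_cases)
  moreover have "U \<inter> X = X" "U \<inter> - X = U - X" using assms by auto
  ultimately show ?thesis
    using assms by (simp add: card_Diff_subset finite_subset real_sqrt_mult real_sqrt_power mult.commute)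
qed

text \<open>A copy in \<open>Z\<close> contributes \<open>1 - l\<close>, any other copy
  \<open>l\<close> times one amplitude for \<open>X\<close> and one for \<open>Y\<close>. Equal
  cardinality makes the two products of amplitudes the same square root, so that diagonal and
  off-diagonal entries agree.\<close>

lemma shared_copies_rho_coherent:
  assumes XYZ: "X \<subseteq> {..<n}" "Y \<subseteq> {..<n}" "Z \<subseteq> {..<n}" "X \<inter> Z = {}" "Y \<inter> Z = {}"
    and card: "card X = card Y" and \<alpha>: "0 \<le> \<alpha>" "\<alpha> \<le> 1"
  shows "shared_copies n (rho \<alpha> l) $$
      (set_encode X * 2 ^ n + set_encode (X \<union> Z), set_encode Y * 2 ^ n + set_encode (Y \<union> Z)) =
    complex_of_real (copies_weight n \<alpha> l (card Z) (card X))"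
proof -
  define s where "s A i = (if i \<in> A then sqrt (1 - \<alpha>) else sqrt \<alpha>)" for A :: "nat set" and i
  let ?U = "{..<n} - Z"
  have fin: "finite Z" using XYZ by (auto intro: finite_subset)
  have cU: "card ?U = n - card Z" using XYZ fin by (simp add: card_Diff_subset)
  have "shared_copies n (rho \<alpha> l) $$
      (set_encode X * 2 ^ n + set_encode (X \<union> Z), set_encode Y * 2 ^ n + set_encode (Y \<union> Z)) =
    (\<Prod>i<n. complex_of_real (if i \<in> Z then 1 - l else l * s X i * s Y i))"
    using XYZ by (subst shared_copies_set_encode) (auto simp: rho_index s_def intro!: prod.cong)
  also have "\<dots> = complex_of_real ((1 - l) ^ card ({..<n} \<inter> Z) * (\<Prod>i\<in>{..<n} \<inter> - Z. l * s X i * s Y i))"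
    by (simp add: prod.If_cases flip: of_real_prod)
  also have "{..<n} \<inter> Z = Z" using XYZ by auto
  also have "{..<n} \<inter> - Z = ?U" by auto
  also have "(\<Prod>i\<in>?U. l * s X i * s Y i) = l ^ (n - card Z) * (prod (s X) ?U * prod (s Y) ?U)"
    by (simp add: prod.distrib cU mult.assoc)
  also have "prod (s X) ?U = sqrt (\<alpha> ^ (n - card Z - card X) * (1 - \<alpha>) ^ card X)"
    unfolding s_def cU[symmetric] using XYZ \<alpha> by (intro prod_sqrt_subset) auto
  also have "prod (s Y) ?U = sqrt (\<alpha> ^ (n - card Z - card X) * (1 - \<alpha>) ^ card X)"
    unfolding s_def cU[symmetric] card using XYZ \<alpha> by (intro prod_sqrt_subset) auto
  finally show ?thesis using \<alpha>
    by (simp add: copies_weight_def mult_ac flip: real_sqrt_mult)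
qed

text \<open>If an inclusion fails, some copy has a one at A and a zero at B, and the entry of
  \<open>rho\<close> at index 2 kills the product.\<close>

lemma shared_copies_rho_zero:
  assumes "A \<subseteq> {..<n}" "B \<subseteq> {..<n}" "C \<subseteq> {..<n}" "D \<subseteq> {..<n}" "\<not> (A \<subseteq> B \<and> C \<subseteq> D)"
  shows "shared_copies n (rho \<alpha> l) $$
    (set_encode A * 2 ^ n + set_encode B, set_encode C * 2 ^ n + set_encode D) = 0"
proof -
  obtain i where "i < n" "i \<in> A \<and> i \<notin> B \<or> i \<in> C \<and> i \<notin> D"
    using assms by blast
  then show ?thesis
    using assms by (subst shared_copies_set_encode) (auto simp: rho_index intro!: bexI[of _ i])
qed

section \<open>Branches with a single selection as reindexing of the state\<close>

lemma apply_kraus_selection: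
  assumes "\<sigma> \<in> carrier_mat d d" "\<And>i. i < e \<Longrightarrow> f i < d"
  shows "apply_kraus e [selection c e d f] \<sigma> =
    mat e e (\<lambda>(i, j). complex_of_real (c\<^sup>2) * \<sigma> $$ (f i, f j))"
  using selection_conjugate[OF assms, where c = c]
  by (simp add: apply_kraus_def mat_sum_def right_add_zero_mat[of _ e e])

lemma apply_kraus_selection_A:
  assumes "\<sigma> \<in> carrier_mat (dA * dB) (dA * dB)" "\<And>i. i < e \<Longrightarrow> f i < dA"
  shows "apply_kraus (e * dB) [tensor_mat (selection c e dA f) (1\<^sub>m dB)] \<sigma> =
    mat (e * dB) (e * dB) (\<lambda>(i, j). complex_of_real (c\<^sup>2) *
      \<sigma> $$ (f (i div dB) * dB + i mod dB, f (j div dB) * dB + j mod dB))"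
proof -
  have "f (i div dB) * dB + i mod dB < dA * dB" if "i < e * dB" for i
  proof -
    have "0 < dB" using that by (cases dB) auto
    then show ?thesis
      by (intro product_index_less assms(2) less_mult_imp_div_less mod_less_divisor that)
  qed
  note less = this
  have eq: "tensor_mat (selection c e dA f) (1\<^sub>m dB) =
      selection c (e * dB) (dA * dB) (\<lambda>i. f (i div dB) * dB + i mod dB)"
    unfolding one_mat_eq_selection using tensor_selection[of dB "\<lambda>i. i" dB c e dA f 1] by simp
  show ?thesis
    unfolding eq by (rule apply_kraus_selection[OF assms(1) less])
qed

lemma apply_kraus_selection_B:
  assumes "\<sigma> \<in> carrier_mat (dA * dB) (dA * dB)" "\<And>i. i < e \<Longrightarrow> g i < dB"
  shows "apply_kraus (dA * e) [tensor_mat (1\<^sub>m dA) (selection c e dB g)] \<sigma> =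
    mat (dA * e) (dA * e) (\<lambda>(i, j). complex_of_real (c\<^sup>2) *
      \<sigma> $$ (i div e * dB + g (i mod e), j div e * dB + g (j mod e)))"
proof -
  have "i div e * dB + g (i mod e) < dA * dB" if "i < dA * e" for i
  proof -
    have "0 < e" using that by (cases e) auto
    then show ?thesis
      by (intro product_index_less assms(2) less_mult_imp_div_less mod_less_divisor that)
  qed
  note less = this
  have eq: "tensor_mat (1\<^sub>m dA) (selection c e dB g) =
      selection c (dA * e) (dA * dB) (\<lambda>i. i div e * dB + g (i mod e))"
    unfolding one_mat_eq_selection using tensor_selection[of e g dB 1 dA dA "\<lambda>i. i" c] assms(2) by simp
  show ?thesis
    unfolding eq by (rule apply_kraus_selection[OF assms(1) less])
qed

section \<open>Counting pairs of subsets of equal size\<close>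

lemma sum_Pow_card:
  fixes h :: "nat \<Rightarrow> real"
  assumes "finite U"
  shows "(\<Sum>X\<in>Pow U. h (card X)) = (\<Sum>k\<le>card U. real (card U choose k) * h k)"
proof -
  have "(\<Sum>X\<in>Pow U. h (card X)) = (\<Sum>k\<le>card U. \<Sum>X\<in>{X \<in> Pow U. card X = k}. h (card X))"
  proof (rule sum.group[symmetric])
    show "card ` Pow U \<subseteq> {..card U}" using assms card_mono by blast
  qed (use assms in simp_all)
  also have "\<dots> = (\<Sum>k\<le>card U. real (card U choose k) * h k)"
    using n_subsets[OF assms] by (intro sum.cong) auto
  finally show ?thesis .
qed

text \<open>The number of partners \<open>Y\<close> depends only on \<open>card X\<close>, which
  leaves a sum over single subsets.\<close>

lemma sum_distinct_subset_pairs: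
  fixes h :: "nat \<Rightarrow> real"
  assumes "finite U"
  shows "(\<Sum>(X, Y)\<in>{(X, Y). X \<subseteq> U \<and> Y \<subseteq> U \<and> X \<noteq> Y \<and> card X = card Y}. h (card X)) =
    (\<Sum>k\<le>card U. real (card U choose k) * (real (card U choose k) - 1) * h k)"
proof -
  have card: "real (card ({Y. Y \<subseteq> U \<and> card Y = card X} - {X})) = real (card U choose card X) - 1"
    if "X \<subseteq> U" for X
  proof -
    \<comment> \<open>Positivity makes the truncated difference of naturals agree with the real
      one.\<close>
    have "0 < card U choose card X" using card_mono[OF assms that] by simp
    then show ?thesis
      using that assms n_subsets[OF assms] by (simp add: card_Diff_singleton_if of_nat_diff Suc_le_eq)
  qed
  have pairs: "{(X, Y). X \<subseteq> U \<and> Y \<subseteq> U \<and> X \<noteq> Y \<and> card X = card Y} =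
      Sigma (Pow U) (\<lambda>X. {Y. Y \<subseteq> U \<and> card Y = card X} - {X})" by auto
  have "(\<Sum>(X, Y)\<in>{(X, Y). X \<subseteq> U \<and> Y \<subseteq> U \<and> X \<noteq> Y \<and> card X = card Y}. h (card X)) =
      (\<Sum>X\<in>Pow U. \<Sum>Y\<in>{Y. Y \<subseteq> U \<and> card Y = card X} - {X}. h (card X))"
    unfolding pairs using assms by (subst sum.Sigma) auto
  also have "\<dots> = (\<Sum>X\<in>Pow U. (real (card U choose card X) - 1) * h (card X))"
    using card by (intro sum.cong) auto
  finally show ?thesis
    using sum_Pow_card[OF assms, of "\<lambda>k. (real (card U choose k) - 1) * h k"]
    by (simp add: mult.assoc)
qed

subsection \<open>The protocol\<close>

text \<open>The candidates for the set of |01> copies once \<open>X\<close> and \<open>Y\<close> are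
  announced: A holds a zero in each such copy.\<close>

definition extensions :: "nat \<Rightarrow> nat set \<Rightarrow> nat set \<Rightarrow> nat set list" where
  "extensions n X Y = filter (\<lambda>Z. Z \<inter> (X \<union> Y) = {}) (subsets n)"

text \<open>The basis vectors of B outside all planes of the extensions; they complete his
  measurement.\<close>

definition other_subsets :: "nat \<Rightarrow> nat set \<Rightarrow> nat set \<Rightarrow> nat set list" where
  "other_subsets n X Y = filter (\<lambda>W. \<forall>Z\<in>set (extensions n X Y). W \<noteq> X \<union> Z \<and> W \<noteq> Y \<union> Z) (subsets n)"

definition pair_index :: "nat set \<Rightarrow> nat set \<Rightarrow> nat \<Rightarrow> nat" where
  "pair_index X Y i = set_encode (if i = 0 then X else Y)"

text \<open>Failing branches of both parties end in dimension 1, where no singlet exists whatever the state is.\<close>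

definition bob :: "nat \<Rightarrow> nat set \<Rightarrow> nat set \<Rightarrow> protocol" where
  "bob n X Y = By_B
    (map (\<lambda>Z. (2, [selection 1 2 (2 ^ n) (pair_index (X \<union> Z) (Y \<union> Z))], Done)) (extensions n X Y) @
     [(1, map (\<lambda>W. selection 1 1 (2 ^ n) (\<lambda>_. set_encode W)) (other_subsets n X Y), Done)])"

definition subset_pairs :: "nat \<Rightarrow> (nat set \<times> nat set) list" where
  "subset_pairs n = filter (\<lambda>(X, Y). X \<noteq> Y \<and> card X = card Y) (List.product (subsets n) (subsets n))"

text \<open>A set of weight \<open>k\<close> lies in \<open>2 * ((n choose k) - 1)\<close> ordered pairs, whence the normalisation.\<close>

definition pair_coeff :: "nat \<Rightarrow> nat set \<Rightarrow> real" where
  "pair_coeff n X = sqrt (1 / (2 * (real (n choose card X) - 1)))"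

text \<open>The planes of different pairs overlap, so this is not a projective measurement, and each
  plane occurs in both orders. The last branch takes the empty and the full set, which have no
  partner of equal size.\<close>

definition alice :: "nat \<Rightarrow> protocol" where
  "alice n = By_A
    (map (\<lambda>(X, Y). (2, [selection (pair_coeff n X) 2 (2 ^ n) (pair_index X Y)], bob n X Y)) (subset_pairs n) @
     [(1, map (\<lambda>X. selection 1 1 (2 ^ n) (\<lambda>_. set_encode X))
         (filter (\<lambda>X. n choose card X = 1) (subsets n)), Done)])"

lemma sum_list_distinct_delta:
  assumes "distinct xs"
  shows "(\<Sum>x\<leftarrow>xs. if x = a then c else (0 :: real)) = (if a \<in> set xs then c else 0)"
  using assms by (simp add: sum_list_distinct_conv_sum_set)

lemma distinct_extensions [simp]: "distinct (extensions n X Y)"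
  by (simp add: extensions_def)

lemma distinct_other_subsets [simp]: "distinct (other_subsets n X Y)"
  by (simp add: other_subsets_def)

lemma binomial_card_pos: "X \<subseteq> {..<n} \<Longrightarrow> 0 < n choose card X"
  using card_mono[of "{..<n}" X] by simp

lemma pair_coeff_square:
  assumes "X \<subseteq> {..<n}"
  shows "(pair_coeff n X)\<^sup>2 = 1 / (2 * (real (n choose card X) - 1))"
proof -
  have "1 \<le> n choose card X" using binomial_card_pos[OF assms] by (simp only: One_nat_def Suc_le_eq)
  \<comment> \<open>The radicand is thus nonnegative; for a binomial coefficient equal to 1 division
    by zero makes it 0.\<close>
  then have "1 \<le> real (n choose card X)" by simp
  then show ?thesis unfolding pair_coeff_def by (intro real_sqrt_pow2) simp
qed

section \<open>Completeness of both measurements\<close>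

text \<open>The sets \<open>X \<union> Z\<close> and \<open>Y \<union> Z\<close> are pairwise
  distinct over all extensions, so each basis vector of B is selected exactly once.\<close>

lemma locc_bob:
  assumes XY: "X \<subseteq> {..<n}" "Y \<subseteq> {..<n}" "X \<noteq> Y" "card X = card Y"
  shows "locc 2 (2 ^ n) (bob n X Y)"
proof -
  have nsub: "\<not> X \<subseteq> Y" "\<not> Y \<subseteq> X"
    using XY by (metis card_subset_eq finite_lessThan finite_subset)+
  define bs where "bs = map (\<lambda>Z. (2 :: nat, [(1 :: real, pair_index (X \<union> Z) (Y \<union> Z))])) (extensions n X Y) @
     [(1, map (\<lambda>W. (1, \<lambda>_ :: nat. set_encode W)) (other_subsets n X Y))]"
  have "instrument (2 ^ n) (map (\<lambda>(e, ps). (e, map (\<lambda>(c, f). selection c e (2 ^ n) f) ps)) bs)"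
  proof (rule instrument_selection)
    fix j :: nat assume "j < 2 ^ n"
    then obtain J where J: "J \<subseteq> {..<n}" "j = set_encode J"
      using set_decode_subset set_decode_inverse by metis
    have ext: "X \<union> Z \<subseteq> {..<n} \<and> Y \<union> Z \<subseteq> {..<n} \<and> Z \<inter> X = {} \<and> Z \<inter> Y = {}"
      if "Z \<in> set (extensions n X Y)" for Z
      using that XY by (auto simp: extensions_def)
    have "(\<Sum>(e, ps)\<leftarrow>bs. \<Sum>(c, f)\<leftarrow>ps. \<Sum>r<e. if f r = j then c\<^sup>2 else 0) =
      (\<Sum>Z\<leftarrow>extensions n X Y. (if X \<union> Z = J then 1 else 0) + (if Y \<union> Z = J then 1 else 0)) +
      (\<Sum>W\<leftarrow>other_subsets n X Y. if W = J then 1 else 0 :: real)"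
      unfolding bs_def J using J ext
      by (auto simp: o_def pair_index_def eval_nat_numeral set_encode_eq_iff[of _ n] other_subsets_def
          intro!: arg_cong2[of _ _ _ _ "(+)"] arg_cong[of _ _ sum_list])
    also have "\<dots> = 1"
    proof (cases "\<exists>Z\<in>set (extensions n X Y). J = X \<union> Z \<or> J = Y \<union> Z")
      case True
      then obtain Z0 where Z0: "Z0 \<in> set (extensions n X Y)" "J = X \<union> Z0 \<or> J = Y \<union> Z0" by blast
      \<comment> \<open>Disjointness recovers \<open>Z\<close> from \<open>X \<union> Z\<close> and
        from \<open>Y \<union> Z\<close>. A coincidence \<open>X \<union> Z = Y \<union> Z0\<close>
        would force \<open>X \<subseteq> Y\<close>, since \<open>Z0\<close> avoids \<open>X\<close>;
        the other mixed case is symmetric.\<close>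
      have "(if X \<union> Z = J then 1 else 0) + (if Y \<union> Z = J then 1 else 0) = (if Z = Z0 then 1 else 0 :: real)"
        if "Z \<in> set (extensions n X Y)" for Z
        using ext[OF that] ext[OF Z0(1)] Z0(2) nsub by auto
      then have "(\<Sum>Z\<leftarrow>extensions n X Y. (if X \<union> Z = J then 1 else 0) + (if Y \<union> Z = J then 1 else 0)) =
          (\<Sum>Z\<leftarrow>extensions n X Y. if Z = Z0 then 1 else 0 :: real)"
        by (intro arg_cong[of _ _ sum_list] map_cong) auto
      moreover have "J \<notin> set (other_subsets n X Y)"
        using True by (auto simp: other_subsets_def)
      ultimately show ?thesis using Z0(1) by (simp add: sum_list_distinct_delta)
    next
      case False
      then have "J \<in> set (other_subsets n X Y)"
        using J by (auto simp: other_subsets_def)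
      moreover have "(if X \<union> Z = J then 1 else 0) + (if Y \<union> Z = J then 1 else 0) = (0 :: real)"
        if "Z \<in> set (extensions n X Y)" for Z
        using False that by auto
      ultimately show ?thesis
        by (simp add: sum_list_distinct_delta cong: map_cong)
    qed
    finally show "(\<Sum>(e, ps)\<leftarrow>bs. \<Sum>(c, f)\<leftarrow>ps. \<Sum>r<e. if f r = j then c\<^sup>2 else 0) = 1" .
  qed
  then show ?thesis
    by (auto simp: bob_def bs_def o_def)
qed

lemma set_subset_pairs:
  "set (subset_pairs n) = {(X, Y). X \<subseteq> {..<n} \<and> Y \<subseteq> {..<n} \<and> X \<noteq> Y \<and> card X = card Y}"
  by (auto simp: subset_pairs_def)

lemma distinct_subset_pairs [simp]: "distinct (subset_pairs n)"
  by (simp add: subset_pairs_def distinct_product)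

text \<open>A set with \<open>N\<close> sets of its size is the first entry of \<open>N - 1\<close>
  pairs and the second of as many, each time with weight 1 / (2 (N - 1)). For \<open>N = 1\<close>
  the failing branch supplies the weight.\<close>

lemma locc_alice: "locc (2 ^ n) (2 ^ n) (alice n)"
proof -
  define ones where "ones = filter (\<lambda>X. n choose card X = 1) (subsets n)"
  define bs where "bs = map (\<lambda>(X, Y). (2 :: nat, [(pair_coeff n X, pair_index X Y)])) (subset_pairs n) @
     [(1, map (\<lambda>X. (1, \<lambda>_ :: nat. set_encode X)) ones)]"
  have "instrument (2 ^ n) (map (\<lambda>(e, ps). (e, map (\<lambda>(c, f). selection c e (2 ^ n) f) ps)) bs)"
  proof (rule instrument_selection)
    fix j :: nat assume "j < 2 ^ n"
    then obtain J where J: "J \<subseteq> {..<n}" "j = set_encode J"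
      using set_decode_subset set_decode_inverse by metis
    let ?N = "n choose card J"
    let ?P = "set (subset_pairs n)"
    have "0 < ?N" by (rule binomial_card_pos[OF J(1)])
    have same: "{Y. Y \<subseteq> {..<n} \<and> Y \<noteq> J \<and> card Y = card J} = {Y. Y \<subseteq> {..<n} \<and> card Y = card J} - {J}"
      by auto
    have c: "card {Y. Y \<subseteq> {..<n} \<and> Y \<noteq> J \<and> card Y = card J} = ?N - 1"
      unfolding same using J by (simp add: n_subsets card_Diff_singleton)
    have "{p \<in> ?P. fst p = J} = Pair J ` {Y. Y \<subseteq> {..<n} \<and> Y \<noteq> J \<and> card Y = card J}"
      using J by (auto simp: set_subset_pairs)
    then have c1: "card {p \<in> ?P. fst p = J} = ?N - 1"
      using c by (simp add: card_image inj_on_def)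
    have "{p \<in> ?P. snd p = J} = (\<lambda>Y. (Y, J)) ` {Y. Y \<subseteq> {..<n} \<and> Y \<noteq> J \<and> card Y = card J}"
      using J by (auto simp: set_subset_pairs)
    then have c2: "card {p \<in> ?P. snd p = J} = ?N - 1"
      using c by (simp add: card_image inj_on_def)
    \<comment> \<open>\<open>pair_coeff\<close> depends only on the cardinality, so the coefficient
      of a pair may be taken at \<open>J\<close> even when \<open>J\<close> is its second
      entry.\<close>
    have "(\<Sum>(e, ps)\<leftarrow>bs. \<Sum>(c, f)\<leftarrow>ps. \<Sum>r<e. if f r = j then c\<^sup>2 else 0) =
      (\<Sum>p\<leftarrow>subset_pairs n. (if fst p = J then (pair_coeff n J)\<^sup>2 else 0) +
        (if snd p = J then (pair_coeff n J)\<^sup>2 else 0)) +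
      (\<Sum>W\<leftarrow>ones. if W = J then 1 else 0 :: real)"
      unfolding bs_def J using J
      by (auto simp: o_def pair_index_def eval_nat_numeral set_encode_eq_iff[of _ n] ones_def
          set_subset_pairs pair_coeff_def
          intro!: arg_cong2[of _ _ _ _ "(+)"] arg_cong[of _ _ sum_list])
    also have "(\<Sum>W\<leftarrow>ones. if W = J then 1 else 0 :: real) = (if ?N = 1 then 1 else 0)"
      using J by (simp add: sum_list_distinct_delta ones_def)
    also have "(\<Sum>p\<leftarrow>subset_pairs n. (if fst p = J then (pair_coeff n J)\<^sup>2 else 0) +
        (if snd p = J then (pair_coeff n J)\<^sup>2 else 0)) =
        (\<Sum>p\<in>?P. if fst p = J then (pair_coeff n J)\<^sup>2 else 0) +
        (\<Sum>p\<in>?P. if snd p = J then (pair_coeff n J)\<^sup>2 else 0)"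
      by (simp add: sum_list_distinct_conv_sum_set sum.distrib)
    also have "\<dots> = 2 * (real (?N - 1) * (pair_coeff n J)\<^sup>2)"
      using c1 c2 by (simp flip: sum.inter_filter)
    also have "2 * (real (?N - 1) * (pair_coeff n J)\<^sup>2) + (if ?N = 1 then 1 else 0) = 1"
      unfolding pair_coeff_square[OF J(1)] using \<open>0 < ?N\<close> by (auto simp: of_nat_diff Suc_le_eq divide_simps)
    finally show "(\<Sum>(e, ps)\<leftarrow>bs. \<Sum>(c, f)\<leftarrow>ps. \<Sum>r<e. if f r = j then c\<^sup>2 else 0) = 1" .
  qed
  then have "instrument (2 ^ n) (map (\<lambda>(e, Ks, Q). (e, Ks))
    (map (\<lambda>(X, Y). (2, [selection (pair_coeff n X) 2 (2 ^ n) (pair_index X Y)], bob n X Y)) (subset_pairs n) @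
     [(1, map (\<lambda>X. selection 1 1 (2 ^ n) (\<lambda>_. set_encode X)) ones, Done)]))"
    by (simp add: bs_def o_def case_prod_unfold)
  then show ?thesis
    unfolding alice_def ones_def[symmetric]
    by (auto simp: set_subset_pairs intro!: locc_bob)
qed

section \<open>Evaluation of the success probability\<close>

text \<open>In the plane of \<open>Z\<close> exactly the four entries between |X, X \<union> Z> and
  |Y, Y \<union> Z> can survive, all with the same value. The projector on \<open>bell_vec\<close>
  has entries 1/2 there, whence the factor 2.\<close>

lemma success_probability_bob:
  fixes \<alpha> l c :: real
  assumes \<alpha>: "0 \<le> \<alpha>" "\<alpha> \<le> 1" and XY: "(X, Y) \<in> set (subset_pairs n)"
  defines "\<sigma> \<equiv> apply_kraus (2 * 2 ^ n)
    [tensor_mat (selection c 2 (2 ^ n) (pair_index X Y)) (1\<^sub>m (2 ^ n))] (shared_copies n (rho \<alpha> l))"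
  shows "success_probability 2 (2 ^ n) (bob n X Y) \<sigma> =
    (\<Sum>Z\<in>{Z. Z \<subseteq> {..<n} \<and> Z \<inter> (X \<union> Y) = {}}. 2 * c\<^sup>2 * copies_weight n \<alpha> l (card Z) (card X))"
proof -
  have sub: "X \<subseteq> {..<n}" "Y \<subseteq> {..<n}" and card: "card X = card Y" and "X \<noteq> Y"
    using XY by (auto simp: set_subset_pairs)
  then have nsub: "\<not> X \<subseteq> Y" "\<not> Y \<subseteq> X"
    by (metis card_subset_eq finite_lessThan finite_subset)+
  have pair_less: "pair_index A B i < 2 ^ n" if "A \<subseteq> {..<n}" "B \<subseteq> {..<n}" for A B i
    using that set_encode_less by (simp add: pair_index_def)
  have \<sigma>: "\<sigma> = mat (2 * 2 ^ n) (2 * 2 ^ n) (\<lambda>(i, j). complex_of_real (c\<^sup>2) *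
      shared_copies n (rho \<alpha> l) $$ (pair_index X Y (i div 2 ^ n) * 2 ^ n + i mod 2 ^ n,
        pair_index X Y (j div 2 ^ n) * 2 ^ n + j mod 2 ^ n))"
    unfolding \<sigma>_def using pair_less sub
    by (intro apply_kraus_selection_A) (auto simp: shared_copies_def)
  have leaf: "success_probability 2 2 Done
      (apply_kraus (2 * 2) [tensor_mat (1\<^sub>m 2) (selection 1 2 (2 ^ n) (pair_index (X \<union> Z) (Y \<union> Z)))] \<sigma>) =
      2 * c\<^sup>2 * copies_weight n \<alpha> l (card Z) (card X)"
    if Z: "Z \<subseteq> {..<n}" "Z \<inter> (X \<union> Y) = {}" for Z
  proof -
    let ?w = "copies_weight n \<alpha> l (card Z) (card X)"
    have less: "pair_index (X \<union> Z) (Y \<union> Z) i < 2 ^ n" for i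
      using Z sub by (intro pair_less) auto
    have div_less: "i div 2 < 2" if "i < 4" for i :: nat using that by auto
    have entry: "shared_copies n (rho \<alpha> l) $$
        (pair_index X Y a * 2 ^ n + pair_index (X \<union> Z) (Y \<union> Z) b,
         pair_index X Y a' * 2 ^ n + pair_index (X \<union> Z) (Y \<union> Z) b') =
        (if a = b \<and> a' = b' then complex_of_real ?w else 0)"
      if "a < 2" "b < 2" "a' < 2" "b' < 2" for a b a' b'
    proof -
      have 2: "a = 0 \<or> a = 1" "b = 0 \<or> b = 1" "a' = 0 \<or> a' = 1" "b' = 0 \<or> b' = 1"
        using that by auto
      show ?thesis
      proof (cases "a = b \<and> a' = b'")
        case True
        have coherent: "shared_copies n (rho \<alpha> l) $$
            (set_encode A * 2 ^ n + set_encode (A \<union> Z), set_encode B * 2 ^ n + set_encode (B \<union> Z)) =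
            complex_of_real ?w" if "A \<in> {X, Y}" "B \<in> {X, Y}" for A B
        proof -
          have "card A = card X" "card A = card B" using that card by auto
          then show ?thesis
            using that sub Z \<alpha> shared_copies_rho_coherent[of A n B Z \<alpha> l] by auto
        qed
        show ?thesis using True 2 coherent by (auto simp: pair_index_def)
      next
        case False
        \<comment> \<open>A mismatch pairs \<open>X\<close> with \<open>Y \<union> Z\<close> or
          \<open>Y\<close> with \<open>X \<union> Z\<close>. Neither is an inclusion, as
          \<open>Z\<close> avoids both sets and they are incomparable.\<close>
        then show ?thesis
          unfolding pair_index_def using sub Z nsub 2
          by (subst shared_copies_rho_zero) auto
      qed
    qed
    have "apply_kraus (2 * 2) [tensor_mat (1\<^sub>m 2) (selection 1 2 (2 ^ n) (pair_index (X \<union> Z) (Y \<union> Z)))] \<sigma> =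
      mat (2 * 2) (2 * 2) (\<lambda>(i, j). complex_of_real (1\<^sup>2) *
        \<sigma> $$ (i div 2 * 2 ^ n + pair_index (X \<union> Z) (Y \<union> Z) (i mod 2),
             j div 2 * 2 ^ n + pair_index (X \<union> Z) (Y \<union> Z) (j mod 2)))"
      by (intro apply_kraus_selection_B less) (simp add: \<sigma>)
    also have "\<dots> = complex_of_real (2 * c\<^sup>2 * ?w) \<cdot>\<^sub>m ketbra bell_vec"
    proof (rule eq_matI)
      show "dim_row (mat (2 * 2) (2 * 2) (\<lambda>(i, j). complex_of_real (1\<^sup>2) *
        \<sigma> $$ (i div 2 * 2 ^ n + pair_index (X \<union> Z) (Y \<union> Z) (i mod 2),
             j div 2 * 2 ^ n + pair_index (X \<union> Z) (Y \<union> Z) (j mod 2)))) =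
        dim_row (complex_of_real (2 * c\<^sup>2 * ?w) \<cdot>\<^sub>m ketbra bell_vec)"
        "dim_col (mat (2 * 2) (2 * 2) (\<lambda>(i, j). complex_of_real (1\<^sup>2) *
        \<sigma> $$ (i div 2 * 2 ^ n + pair_index (X \<union> Z) (Y \<union> Z) (i mod 2),
             j div 2 * 2 ^ n + pair_index (X \<union> Z) (Y \<union> Z) (j mod 2)))) =
        dim_col (complex_of_real (2 * c\<^sup>2 * ?w) \<cdot>\<^sub>m ketbra bell_vec)"
        by simp_all
      fix i j assume "i < dim_row (complex_of_real (2 * c\<^sup>2 * ?w) \<cdot>\<^sub>m ketbra bell_vec)"
        "j < dim_col (complex_of_real (2 * c\<^sup>2 * ?w) \<cdot>\<^sub>m ketbra bell_vec)"
      then have ij: "i < 4" "j < 4" by simp_all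
      \<comment> \<open>Equal binary digits single out 00 and 11, the support of
        \<open>bell_vec\<close>.\<close>
      have diag: "i div 2 = i mod 2 \<longleftrightarrow> i \<in> {0, 3}" if "i < 4" for i :: nat
      proof -
        have "i = 0 \<or> i = 1 \<or> i = 2 \<or> i = 3" using that by auto
        then show ?thesis by auto
      qed
      have in_range: "i div 2 * 2 ^ n + pair_index (X \<union> Z) (Y \<union> Z) (i mod 2) < 2 * 2 ^ n" if "i < 4" for i
        by (intro product_index_less less div_less that)
      show "mat (2 * 2) (2 * 2) (\<lambda>(i, j). complex_of_real (1\<^sup>2) *
        \<sigma> $$ (i div 2 * 2 ^ n + pair_index (X \<union> Z) (Y \<union> Z) (i mod 2),
             j div 2 * 2 ^ n + pair_index (X \<union> Z) (Y \<union> Z) (j mod 2))) $$ (i, j) =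
        (complex_of_real (2 * c\<^sup>2 * ?w) \<cdot>\<^sub>m ketbra bell_vec) $$ (i, j)"
        using ij in_range less
        by (simp add: \<sigma> entry div_less diag bell_index)
    qed
    finally show ?thesis by (simp only: success_probability_bell)
  qed
  have "success_probability 2 (2 ^ n) (bob n X Y) \<sigma> =
      (\<Sum>Z\<leftarrow>extensions n X Y. 2 * c\<^sup>2 * copies_weight n \<alpha> l (card Z) (card X))"
    unfolding bob_def success_probability_By_B
    using leaf by (simp add: o_def, intro arg_cong[of _ _ sum_list] map_cong) (auto simp: extensions_def)
  also have "\<dots> = (\<Sum>Z\<in>{Z. Z \<subseteq> {..<n} \<and> Z \<inter> (X \<union> Y) = {}}. 2 * c\<^sup>2 * copies_weight n \<alpha> l (card Z) (card X))"
    by (simp add: extensions_def sum_list_distinct_conv_sum_set)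
  finally show ?thesis .
qed

text \<open>The sum over triples is reordered with \<open>Z\<close> outermost: \<open>X\<close> and
  \<open>Y\<close> then range over pairs in the complement of \<open>Z\<close>, which has
  \<open>n - card Z\<close> elements, and the counting lemmas apply.\<close>

lemma success_probability_alice:
  assumes \<alpha>: "0 \<le> \<alpha>" "\<alpha> \<le> 1"
  shows "success_probability (2 ^ n) (2 ^ n) (alice n) (shared_copies n (rho \<alpha> l)) =
    (\<Sum>m\<le>n. real (n choose m) * (\<Sum>k\<le>n - m. real ((n - m) choose k) * (real ((n - m) choose k) - 1) *
      (copies_weight n \<alpha> l m k / (real (n choose k) - 1))))"
proof -
  define P where "P U = {(X, Y). X \<subseteq> U \<and> Y \<subseteq> U \<and> X \<noteq> Y \<and> card X = card Y}" for U :: "nat set"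
  define h where "h m k = copies_weight n \<alpha> l m k / (real (n choose k) - 1)" for m k
  have finP: "finite (P {..<n})"
    by (rule finite_subset[of _ "Pow {..<n} \<times> Pow {..<n}"]) (auto simp: P_def)
  have pair: "success_probability 2 (2 ^ n) (bob n X Y)
      (apply_kraus (2 * 2 ^ n) [tensor_mat (selection (pair_coeff n X) 2 (2 ^ n) (pair_index X Y)) (1\<^sub>m (2 ^ n))]
        (shared_copies n (rho \<alpha> l))) =
      (\<Sum>Z\<in>{Z. Z \<subseteq> {..<n} \<and> Z \<inter> (X \<union> Y) = {}}. h (card Z) (card X))"
    if "(X, Y) \<in> set (subset_pairs n)" for X Y
  proof -
    have "X \<subseteq> {..<n}" using that by (auto simp: set_subset_pairs)
    \<comment> \<open>Valid for \<open>d = 0\<close> as well, where both sides are 0.\<close>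
    moreover have "2 * (1 / (2 * d)) * w = w / d" for d w :: real by simp
    ultimately have "2 * (pair_coeff n X)\<^sup>2 * w = w / (real (n choose card X) - 1)" for w
      by (simp only: pair_coeff_square)
    then show ?thesis
      unfolding success_probability_bob[OF \<alpha> that] h_def by simp
  qed
  have "success_probability (2 ^ n) (2 ^ n) (alice n) (shared_copies n (rho \<alpha> l)) =
      (\<Sum>(X, Y)\<leftarrow>subset_pairs n. \<Sum>Z\<in>{Z. Z \<subseteq> {..<n} \<and> Z \<inter> (X \<union> Y) = {}}. h (card Z) (card X))"
    unfolding alice_def success_probability_By_A
    by (auto simp: o_def pair intro!: arg_cong[of _ _ sum_list])
  also have "\<dots> = (\<Sum>(X, Y)\<in>P {..<n}. \<Sum>Z\<in>{Z. Z \<subseteq> {..<n} \<and> Z \<inter> (X \<union> Y) = {}}. h (card Z) (card X))"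
    by (simp add: sum_list_distinct_conv_sum_set set_subset_pairs P_def)
  also have "\<dots> = (\<Sum>(p, Z)\<in>Sigma (P {..<n}) (\<lambda>(X, Y). {Z. Z \<subseteq> {..<n} \<and> Z \<inter> (X \<union> Y) = {}}). h (card Z) (card (fst p)))"
    using finP by (subst sum.Sigma[symmetric]) (auto simp: case_prod_unfold)
  also have "\<dots> = (\<Sum>(Z, p)\<in>Sigma (Pow {..<n}) (\<lambda>Z. P ({..<n} - Z)). h (card Z) (card (fst p)))"
    by (rule sum.reindex_bij_witness[of _ "\<lambda>(Z, p). (p, Z)" "\<lambda>(p, Z). (Z, p)"]) (auto simp: P_def)
  also have "\<dots> = (\<Sum>Z\<in>Pow {..<n}. \<Sum>(X, Y)\<in>P ({..<n} - Z). h (card Z) (card X))"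
    by (subst sum.Sigma)
      (auto simp: case_prod_unfold intro!: finite_subset[OF _ finP], auto simp: P_def)
  also have "\<dots> = (\<Sum>Z\<in>Pow {..<n}. \<Sum>k\<le>n - card Z.
      real ((n - card Z) choose k) * (real ((n - card Z) choose k) - 1) * h (card Z) k)"
  proof (rule sum.cong)
    fix Z assume "Z \<in> Pow {..<n}"
    then have "card ({..<n} - Z) = n - card Z"
      by (auto simp: card_Diff_subset finite_subset)
    then show "(\<Sum>(X, Y)\<in>P ({..<n} - Z). h (card Z) (card X)) = (\<Sum>k\<le>n - card Z.
      real ((n - card Z) choose k) * (real ((n - card Z) choose k) - 1) * h (card Z) k)"
      using sum_distinct_subset_pairs[of "{..<n} - Z" "h (card Z)"] by (simp add: P_def)
  qed simp
  also have "\<dots> = (\<Sum>m\<le>n. real (n choose m) * (\<Sum>k\<le>n - m.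
      real ((n - m) choose k) * (real ((n - m) choose k) - 1) * h m k))"
    using sum_Pow_card[of "{..<n}" "\<lambda>m. \<Sum>k\<le>n - m.
      real ((n - m) choose k) * (real ((n - m) choose k) - 1) * h m k"] by simp
  finally show ?thesis by (simp add: h_def)
qed

theorem mainTheorem2:
  fixes n :: nat and \<alpha> l :: real
  assumes "n \<ge> 2" and "0 \<le> \<alpha>" and "\<alpha> \<le> 1" and "0 \<le> l" and "l \<le> 1"
  shows "\<exists>P. locc (2 ^ n) (2 ^ n) P \<and>
    success_probability (2 ^ n) (2 ^ n) P (shared_copies n (rho \<alpha> l)) =
      (\<Sum>m = 0..n. l ^ (n - m) * (1 - l) ^ m * real (n choose m) *
        (\<Sum>k = 1..n - m - 1.
          \<alpha> ^ (n - m - k) * (1 - \<alpha>) ^ k * real ((n - m) choose k) * (real ((n - m) choose k) - 1) /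
            (real (n choose k) - 1)))"
proof (intro exI conjI)
  show "locc (2 ^ n) (2 ^ n) (alice n)" by (rule locc_alice)
  have inner: "(\<Sum>k\<le>n - m. real ((n - m) choose k) * (real ((n - m) choose k) - 1) *
      (copies_weight n \<alpha> l m k / (real (n choose k) - 1))) =
    l ^ (n - m) * (1 - l) ^ m * (\<Sum>k = 1..n - m - 1.
      \<alpha> ^ (n - m - k) * (1 - \<alpha>) ^ k * real ((n - m) choose k) * (real ((n - m) choose k) - 1) /
        (real (n choose k) - 1))" for m
  proof -
    have "(\<Sum>k\<le>n - m. real ((n - m) choose k) * (real ((n - m) choose k) - 1) *
      (copies_weight n \<alpha> l m k / (real (n choose k) - 1))) =
      (\<Sum>k = 1..n - m - 1. real ((n - m) choose k) * (real ((n - m) choose k) - 1) *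
      (copies_weight n \<alpha> l m k / (real (n choose k) - 1)))"
    proof (rule sum.mono_neutral_right)
      show "\<forall>k\<in>{..n - m} - {1..n - m - 1}. real ((n - m) choose k) * (real ((n - m) choose k) - 1) *
        (copies_weight n \<alpha> l m k / (real (n choose k) - 1)) = 0"
      proof
        fix k assume "k \<in> {..n - m} - {1..n - m - 1}"
        \<comment> \<open>For \<open>m = n\<close> both values coincide and the range
          \<open>1..n - m - 1\<close> is empty. The end terms vanish through the factor
          \<open>((n - m) choose k) - 1\<close>, even where the denominator is 0.\<close>
        then have "k = 0 \<or> k = n - m" by auto
        then have "(n - m) choose k = 1" by auto
        then show "real ((n - m) choose k) * (real ((n - m) choose k) - 1) *
          (copies_weight n \<alpha> l m k / (real (n choose k) - 1)) = 0" by simp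
      qed
    qed auto
    then show ?thesis
      by (simp add: sum_distrib_left copies_weight_def mult_ac)
  qed
  show "success_probability (2 ^ n) (2 ^ n) (alice n) (shared_copies n (rho \<alpha> l)) =
      (\<Sum>m = 0..n. l ^ (n - m) * (1 - l) ^ m * real (n choose m) *
        (\<Sum>k = 1..n - m - 1.
          \<alpha> ^ (n - m - k) * (1 - \<alpha>) ^ k * real ((n - m) choose k) * (real ((n - m) choose k) - 1) /
            (real (n choose k) - 1)))"
    unfolding success_probability_alice[OF assms(2,3)] inner
    by (simp add: atMost_atLeast0 mult_ac)
qed

end
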